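(* Let $Z$ be an arbitrary Banach space, let $X\subset Y$ be separable Banach spaces, and let $T:Y\to\ell^\infty(Z)$ be a bounded linear operator, with $T(y)=(T_n(y))_{n\ge1}$ for all $y\in Y$, such that (i) $T(X)\subset c_0(Z)$, and (ii) $(T_n)$ is relatively compact in the strong operator topology. Then there exists a bounded linear operator $\tilde T:Y\to c_0(Z)$ extending $T|_X$ with $\|\tilde T\|\le2\|T\|$.
   Context: $X\subset Y$ means that $X$ is a closed linear subspace of $Y$. $\ell^\infty(Z)$ is the space of all bounded sequences in $Z$ with the sup norm, and $c_0(Z)$ is its subspace of sequences $(z_j)$ with $\|z_j\|\to0$. The operators $T_n:Y\to Z$ are the coordinates of $T$; the strong operator topology (SOT) on $\mathcal L(Y,Z)$, the bounded linear operators from $Y$ to $Z$, is the topology of pointwise norm convergence on $Y$. Relatively compact means having compact closure in $\mathcal L(Y,Z)$ for this topology. *)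

theory Defs
  imports "HOL-Analysis.Analysis"
begin

text \<open>
  The library's normed spaces are real. To cover real and complex Banach spaces at once, the
  scalars are taken from a type \<open>'k\<close> of class \<open>real_normed_field\<close>, whose norm is multiplicative:
  up to isometric isomorphism the only instances are \<open>real\<close> and \<open>complex\<close>. A Banach space over
  \<open>'k\<close> is a type of class \<open>banach\<close> with a scalar multiplication by \<open>'k\<close> that extends \<open>scaleR\<close>
  and for which the norm is homogeneous. For \<open>'k = real\<close> the only choice is \<open>scaleR\<close>.
\<close>

locale normed_scalars = vector_space scale
  for scale :: "'k::real_normed_field \<Rightarrow> 'a::real_normed_vector \<Rightarrow> 'a" +
  assumes scale_of_real: "scale (of_real r) x = r *\<^sub>R x"
    and norm_scale: "norm (scale c x) = norm c * norm x"

lemma normed_scalars_scaleR: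
  "normed_scalars (scaleR :: real \<Rightarrow> 'a::real_normed_vector \<Rightarrow> 'a)"
  by unfold_locales (auto simp: algebra_simps)

lemma normed_scalars_mult:
  "normed_scalars ((*) :: 'k::real_normed_field \<Rightarrow> 'k \<Rightarrow> 'k)"
  by unfold_locales (auto simp: algebra_simps norm_mult scaleR_conv_of_real)

text \<open>The space \<open>\<L>(Y, Z)\<close> over \<open>'k\<close>; the norm is that of the type \<open>\<Rightarrow>\<^sub>L\<close>, i.e. the operator norm.\<close>

definition bounded_operators ::
  "('k::real_normed_field \<Rightarrow> 'y::real_normed_vector \<Rightarrow> 'y) \<Rightarrow>
   ('k \<Rightarrow> 'z::real_normed_vector \<Rightarrow> 'z) \<Rightarrow> ('y \<Rightarrow>\<^sub>L 'z) set" where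
  "bounded_operators sY sZ = {A. Vector_Spaces.linear sY sZ (blinfun_apply A)}"

definition sot ::
  "('k::real_normed_field \<Rightarrow> 'y::real_normed_vector \<Rightarrow> 'y) \<Rightarrow>
   ('k \<Rightarrow> 'z::real_normed_vector \<Rightarrow> 'z) \<Rightarrow> ('y \<Rightarrow>\<^sub>L 'z) topology" where
  "sot sY sZ = subtopology strong_operator_topology (bounded_operators sY sZ)"

definition relatively_compactin :: "'a topology \<Rightarrow> 'a set \<Rightarrow> bool" where
  "relatively_compactin \<tau> S \<longleftrightarrow> S \<subseteq> topspace \<tau> \<and> compactin \<tau> (\<tau> closure_of S)"

text \<open>
  Every function on the discrete space \<open>nat\<close> is continuous, so \<open>nat \<Rightarrow>\<^sub>C 'z\<close> is the space of all
  bounded sequences in \<open>'z\<close> with the sup norm. Sequences are indexed from \<open>0\<close>.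
\<close>

type_synonym 'z linfty = "nat \<Rightarrow>\<^sub>C 'z"

definition c0 :: "'z::real_normed_vector linfty set" where
  "c0 = {z. (\<lambda>j. norm (apply_bcontfun z j)) \<longlonglongrightarrow> 0}"

definition seq_scale ::
  "('k::real_normed_field \<Rightarrow> 'z::real_normed_vector \<Rightarrow> 'z) \<Rightarrow> 'k \<Rightarrow> 'z linfty \<Rightarrow> 'z linfty" where
  "seq_scale s c z = Bcontfun (\<lambda>j. s c (apply_bcontfun z j))"

context normed_scalars
begin

lemma apply_seq_scale [simp]:
  "apply_bcontfun (seq_scale scale c z) j = scale c (apply_bcontfun z j)"
proof -
  have "(\<lambda>j. scale c (apply_bcontfun z j)) \<in> bcontfun"
    by (rule bcontfun_normI[where b = "norm c * norm z"])
      (auto simp: norm_scale intro!: mult_left_mono norm_bounded)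
  then show ?thesis
    by (simp add: seq_scale_def Bcontfun_inverse)
qed

lemma norm_seq_scale_le: "norm (seq_scale scale c z) \<le> norm c * norm z"
  by (rule norm_bound) (auto simp: norm_scale intro!: mult_left_mono norm_bounded)

lemma normed_scalars_seq_scale: "normed_scalars (seq_scale scale)"
proof
  fix a b :: 'k and x y :: "'a linfty" and r :: real
  show "seq_scale scale a (x + y) = seq_scale scale a x + seq_scale scale a y"
    "seq_scale scale (a + b) x = seq_scale scale a x + seq_scale scale b x"
    "seq_scale scale (of_real r) x = r *\<^sub>R x"
    by (auto intro!: bcontfun_eqI simp: scale_right_distrib scale_left_distrib scale_of_real)
  show one: "seq_scale scale 1 x = x" for x
    by (auto intro!: bcontfun_eqI)
  show assoc: "seq_scale scale a (seq_scale scale b x) = seq_scale scale (a * b) x" for a b x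
    by (auto intro!: bcontfun_eqI)
  show "norm (seq_scale scale a x) = norm a * norm x"
  proof (cases "a = 0")
    case True
    then show ?thesis using norm_seq_scale_le[of a x] by simp
  next
    case False
    have "norm x = norm (seq_scale scale (inverse a) (seq_scale scale a x))"
      using False by (simp add: assoc one)
    also have "\<dots> \<le> inverse (norm a) * norm (seq_scale scale a x)"
      using norm_seq_scale_le[of "inverse a" "seq_scale scale a x"]
      by (simp add: norm_inverse)
    finally have "norm a * norm x \<le> norm (seq_scale scale a x)"
      using False by (simp add: field_simps)
    then show ?thesis using norm_seq_scale_le[of a x] by simp
  qed
qed

end

definition coord ::
  "('y::real_normed_vector \<Rightarrow>\<^sub>L 'z::real_normed_vector linfty) \<Rightarrow> nat \<Rightarrow> ('y \<Rightarrow>\<^sub>L 'z)" where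
  "coord T n = Blinfun (\<lambda>y. apply_bcontfun (blinfun_apply T y) n)"

lemma coord_apply [simp]:
  "blinfun_apply (coord T n) y = apply_bcontfun (blinfun_apply T y) n"
proof -
  have "bounded_linear (\<lambda>y. apply_bcontfun (blinfun_apply T y) n)"
  proof (rule bounded_linear_intro[where K = "norm T"])
    fix x show "norm (apply_bcontfun (blinfun_apply T x) n) \<le> norm x * norm T"
      using norm_bounded[of "blinfun_apply T x" n] norm_blinfun[of T x]
      by (simp add: mult.commute)
  qed (simp_all add: blinfun.add_right blinfun.scaleR_right)
  then show ?thesis
    by (simp add: coord_def bounded_linear_Blinfun_apply)
qed

end

theory Submission
  imports Defs
begin

text \<open>
  The idea is to subtract from each coordinate \<open>T\<^sub>n\<close> an operator \<open>S\<^sub>n\<close> that vanishes on \<open>X\<close>, so that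
  the restriction to \<open>X\<close> does not change, while the differences tend to zero strongly on all
  of \<open>Y\<close>. If moreover \<open>norm S\<^sub>n \<le> norm T\<close>, then \<open>T' y = (T\<^sub>n y - S\<^sub>n y)\<^sub>n\<close> has norm at most
  \<open>2 * norm T\<close>.

  The candidates for \<open>S\<^sub>n\<close> come from the compactness of the set of coordinates. Every strong cluster
  point of \<open>(T\<^sub>n)\<close>, along any infinite set of indices, is linear, has norm at most \<open>norm T\<close>, and
  vanishes on \<open>X\<close> because \<open>T\<^sub>n x \<longlonglongrightarrow> 0\<close> for \<open>x \<in> X\<close>. If infinitely many \<open>T\<^sub>n\<close> stayed away, on some
  finite set of vectors, from all operators with these three properties, a cluster point along those
  indices would be a contradiction (\<open>eventually_near_annihilators\<close>). So on each finite set the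
  \<open>T\<^sub>n\<close> are eventually as close as desired to such operators.

  It remains to choose \<open>S\<^sub>n\<close> independently of the finite set and the precision. A dense
  sequence in \<open>Y\<close> reduces this to countably many requirements, a diagonal choice meets them all
  (\<open>diagonal_choice\<close>), and convergence passes from the dense sequence to \<open>Y\<close> by
  equiboundedness.
\<close>

section \<open>Cluster points and diagonal choice\<close>

text \<open>
  This speaks of clustering in the index \<open>n\<close>, not in the set of values, because the sequence may
  take one value infinitely often.
\<close>

lemma compactin_sequence_cluster_point:
  fixes a :: "nat \<Rightarrow> 'a"
  assumes "compactin \<tau> K" and "range a \<subseteq> K" and "infinite N"
  obtains x where "x \<in> K" and "\<And>U. openin \<tau> U \<Longrightarrow> x \<in> U \<Longrightarrow> infinite {n \<in> N. a n \<in> U}"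
proof -
  have "\<exists>x\<in>K. \<forall>U. openin \<tau> U \<longrightarrow> x \<in> U \<longrightarrow> infinite {n \<in> N. a n \<in> U}"
  proof (rule ccontr)
    assume "\<not> ?thesis"
    then have "\<forall>x\<in>K. \<exists>U. openin \<tau> U \<and> x \<in> U \<and> finite {n \<in> N. a n \<in> U}"
      by blast
    then obtain U where U: "\<And>x. x \<in> K \<Longrightarrow> openin \<tau> (U x) \<and> x \<in> U x \<and> finite {n \<in> N. a n \<in> U x}"
      by metis
    have "\<exists>\<F>. finite \<F> \<and> \<F> \<subseteq> U ` K \<and> K \<subseteq> \<Union> \<F>"
      by (rule compactinD[OF assms(1)]) (use U in blast)+
    then obtain F where F: "finite F" "F \<subseteq> K" "K \<subseteq> \<Union> (U ` F)"
      by (metis finite_subset_image)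
    have "N \<subseteq> (\<Union>x\<in>F. {n \<in> N. a n \<in> U x})"
      using F(3) assms(2) by blast
    moreover have "finite (\<Union>x\<in>F. {n \<in> N. a n \<in> U x})"
      using F U by blast
    ultimately show False
      using assms(3) finite_subset by blast
  qed
  with that show thesis by blast
qed

text \<open>
  At index \<open>n\<close> the element is chosen for the strongest requirement of rank at most \<open>n\<close> that can be
  met there. Since each requirement can eventually be met, this rank exceeds any given one for
  large \<open>n\<close>.
\<close>

lemma diagonal_choice:
  fixes P :: "nat \<Rightarrow> nat \<Rightarrow> 'a \<Rightarrow> bool"
  assumes "V \<noteq> {}"
    and ev: "\<And>k. eventually (\<lambda>n. \<exists>s\<in>V. P k n s) sequentially"
    and antimono: "\<And>j k n s. j \<le> k \<Longrightarrow> P k n s \<Longrightarrow> P j n s"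
  obtains s where "\<And>n. s n \<in> V" and "\<And>k. eventually (\<lambda>n. P k n (s n)) sequentially"
proof -
  have "\<exists>s\<in>V. \<forall>k\<le>n. (\<exists>t\<in>V. P k n t) \<longrightarrow> P k n s" for n
  proof (cases "\<exists>k\<le>n. \<exists>t\<in>V. P k n t")
    case True
    let ?K = "{k. k \<le> n \<and> (\<exists>t\<in>V. P k n t)}"
    have fin: "finite ?K" by simp
    have "Max ?K \<in> ?K"
      using Max_in[OF fin] True by blast
    then obtain s where s: "s \<in> V" "P (Max ?K) n s" by blast
    have "P k n s" if "k \<in> ?K" for k
      using antimono[OF Max_ge[OF fin that] s(2)] .
    with s(1) show ?thesis by blast
  next
    case False
    with assms(1) show ?thesis by blast
  qed
  then obtain s where s: "\<And>n. s n \<in> V" "\<And>n k. k \<le> n \<Longrightarrow> \<exists>t\<in>V. P k n t \<Longrightarrow> P k n (s n)"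
    by metis
  have "eventually (\<lambda>n. P k n (s n)) sequentially" for k
    using ev[of k] eventually_ge_at_top[of k] by eventually_elim (use s(2) in blast)
  with s(1) that show thesis by blast
qed

section \<open>Operators into spaces of bounded sequences\<close>

lemma blinfun_from_coords:
  fixes A :: "nat \<Rightarrow> 'y::real_normed_vector \<Rightarrow>\<^sub>L 'z::real_normed_vector"
  assumes bound: "\<And>n. norm (A n) \<le> c"
  obtains B :: "'y \<Rightarrow>\<^sub>L 'z linfty"
  where "\<And>y n. apply_bcontfun (blinfun_apply B y) n = blinfun_apply (A n) y" and "norm B \<le> c"
proof -
  define f where "f y = Bcontfun (\<lambda>n. blinfun_apply (A n) y)" for y
  have le: "norm (blinfun_apply (A n) y) \<le> c * norm y" for n y
    using norm_blinfun[of "A n" y] mult_right_mono[OF bound[of n] norm_ge_zero[of y]] by linarith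
  have f [simp]: "apply_bcontfun (f y) n = blinfun_apply (A n) y" for y n
  proof -
    have "(\<lambda>n. blinfun_apply (A n) y) \<in> bcontfun"
      by (rule bcontfun_normI[where b = "c * norm y"]) (auto intro: le)
    then show ?thesis
      by (simp add: f_def Bcontfun_inverse)
  qed
  have norm_f: "norm (f y) \<le> c * norm y" for y
    by (rule norm_bound) (simp add: le)
  have bl: "bounded_linear f"
  proof (rule bounded_linear_intro[where K = c])
    show "norm (f y) \<le> norm y * c" for y
      using norm_f[of y] by (simp add: mult.commute)
  qed (auto intro!: bcontfun_eqI simp: blinfun.add_right blinfun.scaleR_right)
  have c: "0 \<le> c"
    using bound[of 0] norm_ge_zero[of "A 0"] by linarith
  show thesis
  proof (rule that)
    show "apply_bcontfun (blinfun_apply (Blinfun f) y) n = blinfun_apply (A n) y" for y n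
      by (simp add: bounded_linear_Blinfun_apply[OF bl])
    show "norm (Blinfun f) \<le> c"
      by (rule norm_blinfun_bound[OF c])
        (simp add: bounded_linear_Blinfun_apply[OF bl] norm_f)
  qed
qed

lemma norm_coord_le: "norm (coord T n) \<le> norm T"
proof (rule norm_blinfun_bound)
  show "norm (blinfun_apply (coord T n) y) \<le> norm T * norm y" for y
    using norm_bounded[of "blinfun_apply T y" n] norm_blinfun[of T y] by simp
qed simp

lemma equibounded_tendsto_zero_closure:
  fixes D :: "nat \<Rightarrow> 'y::real_normed_vector \<Rightarrow>\<^sub>L 'z::real_normed_vector"
  assumes bound: "\<And>n. norm (D n) \<le> c"
    and conv: "\<And>y. y \<in> C \<Longrightarrow> (\<lambda>n. blinfun_apply (D n) y) \<longlonglongrightarrow> 0"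
    and "y \<in> closure C"
  shows "(\<lambda>n. blinfun_apply (D n) y) \<longlonglongrightarrow> 0"
proof (rule tendstoI)
  fix e :: real assume "0 < e"
  have c: "0 \<le> c"
    using bound[of 0] norm_ge_zero[of "D 0"] by linarith
  define d where "d = e / (2 * (c + 1))"
  have "0 < d" using \<open>0 < e\<close> c by (simp add: d_def)
  then obtain u where u: "u \<in> C" "dist u y < d"
    using assms(3) closure_approachable by blast
  have "eventually (\<lambda>n. dist (blinfun_apply (D n) u) 0 < e / 2) sequentially"
    using conv[OF u(1)] \<open>0 < e\<close> by (intro tendstoD) auto
  then show "eventually (\<lambda>n. dist (blinfun_apply (D n) y) 0 < e) sequentially"
  proof eventually_elim
    case (elim n)
    have "norm (blinfun_apply (D n) (y - u)) \<le> norm (D n) * norm (y - u)"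
      by (rule norm_blinfun)
    also have "\<dots> \<le> (c + 1) * d"
      using bound[of n] u(2) c by (intro mult_mono) (auto simp: dist_norm norm_minus_commute)
    also have "\<dots> = e / 2"
      using c by (simp add: d_def field_simps)
    finally have "norm (blinfun_apply (D n) y - blinfun_apply (D n) u) \<le> e / 2"
      by (simp add: blinfun.diff_right)
    then show ?case
      using elim norm_triangle_sub[of "blinfun_apply (D n) y" "blinfun_apply (D n) u"] by simp
  qed
qed

section \<open>Approximation by operators vanishing on a subset\<close>

lemma openin_sot_ball:
  assumes "finite F"
  shows "openin (sot sY sZ)
    {A \<in> bounded_operators sY sZ. \<forall>y\<in>F. norm (blinfun_apply A y - blinfun_apply S y) < e}"
proof -
  have "openin strong_operator_topology
      {A. \<forall>y\<in>F. blinfun_apply A y \<in> ball (blinfun_apply S y) e}"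
    using strong_operator_topology_basis[OF assms, of "\<lambda>y. ball (blinfun_apply S y) e" "\<lambda>y. y"]
    by simp
  then show ?thesis
    unfolding sot_def openin_subtopology
    by (intro exI conjI) (auto simp: dist_norm norm_minus_commute)
qed

definition annihilators ::
  "('k::real_normed_field \<Rightarrow> 'y::real_normed_vector \<Rightarrow> 'y) \<Rightarrow>
   ('k \<Rightarrow> 'z::real_normed_vector \<Rightarrow> 'z) \<Rightarrow> 'y set \<Rightarrow> real \<Rightarrow> ('y \<Rightarrow>\<^sub>L 'z) set" where
  "annihilators sY sZ X c =
    {S \<in> bounded_operators sY sZ. norm S \<le> c \<and> (\<forall>x\<in>X. blinfun_apply S x = 0)}"

text \<open>
  All strong cluster points are annihilators of \<open>X\<close> with the norm bound, so by compactness the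
  sequence approaches the set of these, on each finite set of vectors; it need not approach a
  single one of them.
\<close>

lemma eventually_near_annihilators:
  fixes A :: "nat \<Rightarrow> 'y::real_normed_vector \<Rightarrow>\<^sub>L 'z::real_normed_vector"
  assumes compact: "relatively_compactin (sot sY sZ) (range A)"
    and bound: "\<And>n. norm (A n) \<le> c"
    and null: "\<And>x. x \<in> X \<Longrightarrow> (\<lambda>n. blinfun_apply (A n) x) \<longlonglongrightarrow> 0"
    and "finite F" and "0 < e"
  shows "eventually (\<lambda>n. \<exists>S \<in> annihilators sY sZ X c.
           \<forall>y\<in>F. norm (blinfun_apply (A n) y - blinfun_apply S y) < e) sequentially"
proof (rule ccontr)
  let ?near = "\<lambda>n. \<exists>S \<in> annihilators sY sZ X c.
    \<forall>y\<in>F. norm (blinfun_apply (A n) y - blinfun_apply S y) < e"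
  assume "\<not> eventually ?near sequentially"
  then have inf: "infinite {n. \<not> ?near n}"
    by (simp add: cofinite_eq_sequentially[symmetric] eventually_cofinite)
  let ?\<tau> = "sot sY sZ"
  have sub: "range A \<subseteq> ?\<tau> closure_of range A" and K: "compactin ?\<tau> (?\<tau> closure_of range A)"
    using compact by (auto simp: relatively_compactin_def intro: closure_of_subset[THEN subsetD])
  obtain S where S: "S \<in> ?\<tau> closure_of range A"
    and cl: "\<And>U. openin ?\<tau> U \<Longrightarrow> S \<in> U \<Longrightarrow> infinite {n \<in> {n. \<not> ?near n}. A n \<in> U}"
    
    by (rule compactin_sequence_cluster_point[OF K sub inf]) (rule that)
  have SB: "S \<in> bounded_operators sY sZ"
    using S closure_of_subset_topspace[of ?\<tau> "range A"] by (auto simp: sot_def)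
  have freq: "infinite {n. \<not> ?near n \<and> (\<forall>y\<in>G. norm (blinfun_apply (A n) y - blinfun_apply S y) < d)}"
    if "finite G" "0 < d" for G d
    by (rule infinite_super[OF _ cl[OF openin_sot_ball[OF that(1), of sY sZ S d]]])
      (use SB that(2) in auto)
  have Sx: "blinfun_apply S x = 0" if "x \<in> X" for x
  proof (rule ccontr)
    assume "blinfun_apply S x \<noteq> 0"
    then have pos: "0 < norm (blinfun_apply S x) / 2" by simp
    have "eventually (\<lambda>n. norm (blinfun_apply (A n) x) < norm (blinfun_apply S x) / 2) sequentially"
      using tendstoD[OF null[OF that] pos] by simp
    then have "finite {n. \<not> norm (blinfun_apply (A n) x) < norm (blinfun_apply S x) / 2}"
      by (simp add: cofinite_eq_sequentially[symmetric] eventually_cofinite)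
    moreover have "{n. \<not> ?near n \<and> (\<forall>y\<in>{x}. norm (blinfun_apply (A n) y - blinfun_apply S y)
        < norm (blinfun_apply S x) / 2)}
      \<subseteq> {n. \<not> norm (blinfun_apply (A n) x) < norm (blinfun_apply S x) / 2}"
    proof clarsimp
      fix n
      assume "norm (blinfun_apply (A n) x - blinfun_apply S x) * 2 < norm (blinfun_apply S x)"
        and "norm (blinfun_apply (A n) x) * 2 < norm (blinfun_apply S x)"
      then show False
        using norm_triangle_sub[of "blinfun_apply S x" "blinfun_apply (A n) x"]
        by (simp add: norm_minus_commute)
    qed
    ultimately show False
      using freq[of "{x}", OF _ pos] finite_subset by blast
  qed
  have c: "0 \<le> c"
    using bound[of 0] norm_ge_zero[of "A 0"] by linarith
  have "norm S \<le> c"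
  proof (rule norm_blinfun_bound[OF c])
    fix y
    show "norm (blinfun_apply S y) \<le> c * norm y"
    proof (rule field_le_epsilon)
      fix d :: real assume "0 < d"
      then obtain n where n: "norm (blinfun_apply (A n) y - blinfun_apply S y) < d"
        using infinite_imp_nonempty[OF freq[of "{y}" d]] by auto
      have "norm (blinfun_apply (A n) y) \<le> c * norm y"
        using norm_blinfun[of "A n" y] mult_right_mono[OF bound[of n] norm_ge_zero[of y]] by linarith
      with n show "norm (blinfun_apply S y) \<le> c * norm y + d"
        using norm_triangle_sub[of "blinfun_apply S y" "blinfun_apply (A n) y"]
        by (simp add: norm_minus_commute)
    qed
  qed
  with SB Sx have "S \<in> annihilators sY sZ X c"
    by (simp add: annihilators_def)
  \<comment> \<open>The cluster point itself is an annihilator close to some \<open>A n\<close> that has none close by.\<close>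
  moreover obtain n where "\<not> ?near n"
    and "\<forall>y\<in>F. norm (blinfun_apply (A n) y - blinfun_apply S y) < e"
    using infinite_imp_nonempty[OF freq[OF assms(4,5)]] by blast
  ultimately show False by blast
qed

lemma strongly_asymptotic_annihilators:
  fixes A :: "nat \<Rightarrow> 'y::real_normed_vector \<Rightarrow>\<^sub>L 'z::real_normed_vector"
  assumes sep: "separable_space (euclidean :: 'y topology)"
    and compact: "relatively_compactin (sot sY sZ) (range A)"
    and bound: "\<And>n. norm (A n) \<le> c"
    and null: "\<And>x. x \<in> X \<Longrightarrow> (\<lambda>n. blinfun_apply (A n) x) \<longlonglongrightarrow> 0"
  obtains S where "\<And>n. S n \<in> annihilators sY sZ X c"
    and "\<And>y. (\<lambda>n. blinfun_apply (A n - S n) y) \<longlonglongrightarrow> 0"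
proof -
  obtain C :: "'y set" where C: "countable C" "closure C = UNIV"
    using sep by (auto simp: separable_space_def)
  then have "C \<noteq> {}" by auto
  let ?u = "from_nat_into C"
  let ?P = "\<lambda>k n S. \<forall>j\<le>k. norm (blinfun_apply (A n) (?u j) - blinfun_apply S (?u j)) < 1 / real (Suc k)"
  have near: "eventually (\<lambda>n. \<exists>S \<in> annihilators sY sZ X c. ?P k n S) sequentially" for k
    using eventually_near_annihilators[OF compact bound null, of X "?u ` {..k}" "1 / real (Suc k)"]
    by (simp, simp add: Ball_def)
  have nonempty: "annihilators sY sZ X c \<noteq> {}"
    using eventually_happens[OF near[of 0]] by auto
  have antimono: "?P j n S" if "j \<le> k" "?P k n S" for j k n S
  proof (intro allI impI)
    fix i assume "i \<le> j"
    then have "norm (blinfun_apply (A n) (?u i) - blinfun_apply S (?u i)) < 1 / real (Suc k)"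
      using that by simp
    also have "\<dots> \<le> 1 / real (Suc j)"
      using that(1) by (intro divide_left_mono) auto
    finally show "norm (blinfun_apply (A n) (?u i) - blinfun_apply S (?u i)) < 1 / real (Suc j)" .
  qed
  obtain S where S: "\<And>n. S n \<in> annihilators sY sZ X c"
    and ev: "\<And>k. eventually (\<lambda>n. ?P k n (S n)) sequentially"
    by (rule diagonal_choice[of _ ?P, OF nonempty near])
      (rule antimono, assumption+, rule that)
  have on_C: "(\<lambda>n. blinfun_apply (A n - S n) y) \<longlonglongrightarrow> 0" if y: "y \<in> C" for y
  proof (rule tendstoI)
    fix e :: real assume "0 < e"
    obtain j where j: "?u j = y"
      using from_nat_into_surj[OF C(1) y] by blast
    obtain m where m: "1 / real (Suc m) < e"
      using nat_approx_posE[OF \<open>0 < e\<close>] by blast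
    have "1 / real (Suc (max j m)) \<le> 1 / real (Suc m)"
      by (intro divide_left_mono) auto
    with m have "1 / real (Suc (max j m)) < e" by linarith
    moreover have "eventually (\<lambda>n. norm (blinfun_apply (A n) y - blinfun_apply (S n) y)
        < 1 / real (Suc (max j m))) sequentially"
      using ev[of "max j m"] by eventually_elim (use j in auto)
    ultimately show "eventually (\<lambda>n. dist (blinfun_apply (A n - S n) y) 0 < e) sequentially"
      by (auto elim!: eventually_mono simp: blinfun.diff_left)
  qed
  have "norm (A n - S n) \<le> c + c" for n
    using norm_triangle_ineq4[of "A n" "S n"] bound[of n] S[of n] by (simp add: annihilators_def)
  then have "(\<lambda>n. blinfun_apply (A n - S n) y) \<longlonglongrightarrow> 0" for y
    by (rule equibounded_tendsto_zero_closure[where C = C, OF _ on_C]) (simp_all add: C(2))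
  with S that show thesis by blast
qed

section \<open>The extension\<close>

theorem theorem1p9:
  fixes scaleY :: "'k::real_normed_field \<Rightarrow> 'y::banach \<Rightarrow> 'y"
    and scaleZ :: "'k \<Rightarrow> 'z::banach \<Rightarrow> 'z"
    and X :: "'y set"
    and T :: "'y \<Rightarrow>\<^sub>L 'z linfty"
  assumes "normed_scalars scaleY" and "normed_scalars scaleZ"
    and "separable_space (euclidean :: 'y topology)"
    and "module.subspace scaleY X" and "closed X"
    and "separable_space (top_of_set X)"
    and "T \<in> bounded_operators scaleY (seq_scale scaleZ)"
    and "blinfun_apply T ` X \<subseteq> c0"
    and "relatively_compactin (sot scaleY scaleZ) (range (coord T))"
  shows "\<exists>T' \<in> bounded_operators scaleY (seq_scale scaleZ).
           range (blinfun_apply T') \<subseteq> c0 \<and>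
           (\<forall>x\<in>X. blinfun_apply T' x = blinfun_apply T x) \<and>
           norm T' \<le> 2 * norm T"
proof -
  have null: "(\<lambda>n. blinfun_apply (coord T n) x) \<longlonglongrightarrow> 0" if "x \<in> X" for x
    using assms(8) that by (auto simp: c0_def tendsto_norm_zero_iff)
  obtain S where S: "\<And>n. S n \<in> annihilators scaleY scaleZ X (norm T)"
    and lim: "\<And>y. (\<lambda>n. blinfun_apply (coord T n - S n) y) \<longlonglongrightarrow> 0"
    by (rule strongly_asymptotic_annihilators[OF assms(3,9) norm_coord_le, of X])
      (rule null, assumption, rule that)
  have bound: "norm (coord T n - S n) \<le> 2 * norm T" for n
    using norm_triangle_ineq4[of "coord T n" "S n"] norm_coord_le[of T n] S[of n]
    by (simp add: annihilators_def)
  obtain T' :: "'y \<Rightarrow>\<^sub>L 'z linfty"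
    where T': "\<And>y n. apply_bcontfun (blinfun_apply T' y) n = blinfun_apply (coord T n - S n) y"
      and norm_T': "norm T' \<le> 2 * norm T"
    by (rule blinfun_from_coords[OF bound]) (rule that)
  interpret Z: normed_scalars scaleZ by (rule assms(2))
  interpret T: Vector_Spaces.linear scaleY "seq_scale scaleZ" "blinfun_apply T"
    using assms(7) by (simp add: bounded_operators_def)
  have "Vector_Spaces.linear scaleY (seq_scale scaleZ) (blinfun_apply T')"
  proof unfold_locales
    show "blinfun_apply T' (scaleY r y) = seq_scale scaleZ r (blinfun_apply T' y)" for r y
    proof (rule bcontfun_eqI)
      fix n
      interpret S: Vector_Spaces.linear scaleY scaleZ "blinfun_apply (S n)"
        using S[of n] by (simp add: annihilators_def bounded_operators_def)
      show "apply_bcontfun (blinfun_apply T' (scaleY r y)) n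
          = apply_bcontfun (seq_scale scaleZ r (blinfun_apply T' y)) n"
        by (simp add: T' blinfun.diff_left T.scale S.scale Z.scale_right_diff_distrib)
    qed
  qed (simp add: blinfun.add_right)
  moreover have "range (blinfun_apply T') \<subseteq> c0"
    using lim by (auto simp: c0_def T' intro: tendsto_norm_zero)
  moreover have "\<forall>x\<in>X. blinfun_apply T' x = blinfun_apply T x"
    using S by (auto intro!: bcontfun_eqI simp: T' blinfun.diff_left annihilators_def)
  ultimately show ?thesis
    using norm_T' by (auto simp: bounded_operators_def)
qed

end
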